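(* There exist a positive integer $t$ and a constant $c>0$ such that for every integer $n\geq 3$ (logarithms natural), $$R_t(3,n)\geq c\, n\frac{\log n}{\log\log n}.$$
   Context: A function $f:\mathbb{R}^{m}\to\mathbb{R}$ is linear if $f(\mathbf{x})=b+\sum_{i=1}^m a_i\mathbf{x}(i)$ for some reals $a_1,\dots,a_m,b$. A (finite, simple) graph $G$ is semilinear of complexity $t$ if $V(G)\subset\mathbb{R}^d$ for some positive integer $d$, and there are $t$ linear functions $f_1,\dots,f_t:\mathbb{R}^d\times\mathbb{R}^d\to\mathbb{R}$ and a Boolean function $\phi:\{\mathrm{F},\mathrm{T}\}^{3t}\to\{\mathrm{F},\mathrm{T}\}$ such that for distinct $\mathbf{x},\mathbf{y}\in V(G)$, $\{\mathbf{x},\mathbf{y}\}$ is an edge iff $\phi\big(\{f_i(\mathbf{x},\mathbf{y})<0,\ f_i(\mathbf{x},\mathbf{y})\leq 0,\ f_i(\mathbf{x},\mathbf{y})=0\}_{i\in[t]}\big)=\mathrm{T}$; it is assumed that this truth value is unchanged when $\mathbf{x}$ and $\mathbf{y}$ are swapped. $R_t(s,n)$ denotes the smallest $N$ such that every semilinear graph of complexity $t$ on $N$ vertices contains a clique of size $s$ or an independent set of size $n$. *)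

theory Defs
  imports Complex_Main
begin

text \<open>Points of R^d are represented as functions nat => real that vanish
  at all coordinates i >= d.  A linear function R^d x R^d -> R is given by
  coefficient vectors a, a' and a constant b.\<close>

definition in_Rd :: "nat \<Rightarrow> (nat \<Rightarrow> real) \<Rightarrow> bool" where
  "in_Rd d x \<longleftrightarrow> (\<forall>i\<ge>d. x i = 0)"

type_synonym linfun = "(nat \<Rightarrow> real) \<times> (nat \<Rightarrow> real) \<times> real"

definition eval_lin :: "nat \<Rightarrow> linfun \<Rightarrow> (nat \<Rightarrow> real) \<Rightarrow> (nat \<Rightarrow> real) \<Rightarrow> real" where
  "eval_lin d f x y = (case f of (a, a', b) \<Rightarrow>
      b + (\<Sum>i<d. a i * x i) + (\<Sum>i<d. a' i * y i))"

definition sign_pattern :: "nat \<Rightarrow> linfun list \<Rightarrow> (nat \<Rightarrow> real) \<Rightarrow> (nat \<Rightarrow> real)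
    \<Rightarrow> (bool \<times> bool \<times> bool) list" where
  "sign_pattern d fs x y =
     map (\<lambda>f. (eval_lin d f x y < 0, eval_lin d f x y \<le> 0, eval_lin d f x y = 0)) fs"

text \<open>A graph (V, E): V a finite vertex set, E the adjacency relation
  (only used on pairs of distinct vertices of V).  It is semilinear of
  complexity t if V lies in some R^d and adjacency of distinct vertices is
  given by a Boolean function of the sign pattern of t linear functions,
  with that truth value symmetric.\<close>
definition semilinear_graph ::
  "nat \<Rightarrow> (nat \<Rightarrow> real) set \<Rightarrow> ((nat \<Rightarrow> real) \<Rightarrow> (nat \<Rightarrow> real) \<Rightarrow> bool) \<Rightarrow> bool" where
  "semilinear_graph t V E \<longleftrightarrow> finite V \<and>
     (\<exists>d>0. \<exists>fs :: linfun list. \<exists>\<phi> :: (bool \<times> bool \<times> bool) list \<Rightarrow> bool.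
        length fs = t \<and> (\<forall>x\<in>V. in_Rd d x) \<and>
        (\<forall>x\<in>V. \<forall>y\<in>V. x \<noteq> y \<longrightarrow>
            (\<phi> (sign_pattern d fs x y) \<longleftrightarrow> \<phi> (sign_pattern d fs y x))) \<and>
        (\<forall>x\<in>V. \<forall>y\<in>V. x \<noteq> y \<longrightarrow> (E x y \<longleftrightarrow> \<phi> (sign_pattern d fs x y))))"

definition has_clique :: "(nat \<Rightarrow> real) set \<Rightarrow> ((nat \<Rightarrow> real) \<Rightarrow> (nat \<Rightarrow> real) \<Rightarrow> bool) \<Rightarrow> nat \<Rightarrow> bool" where
  "has_clique V E s \<longleftrightarrow> (\<exists>K\<subseteq>V. card K = s \<and> (\<forall>x\<in>K. \<forall>y\<in>K. x \<noteq> y \<longrightarrow> E x y))"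

definition has_indep :: "(nat \<Rightarrow> real) set \<Rightarrow> ((nat \<Rightarrow> real) \<Rightarrow> (nat \<Rightarrow> real) \<Rightarrow> bool) \<Rightarrow> nat \<Rightarrow> bool" where
  "has_indep V E n \<longleftrightarrow> (\<exists>I\<subseteq>V. card I = n \<and> (\<forall>x\<in>I. \<forall>y\<in>I. x \<noteq> y \<longrightarrow> \<not> E x y))"

definition semilinear_ramsey :: "nat \<Rightarrow> nat \<Rightarrow> nat \<Rightarrow> nat" where
  "semilinear_ramsey t s n = (LEAST N. \<forall>V E. semilinear_graph t V E \<and> card V = N \<longrightarrow>
      has_clique V E s \<or> has_indep V E n)"

end

theory Submission
  imports Defs "HOL-Library.Ramsey"
begin

text \<open>Consider flags \<open>(p, k)\<close> of a point \<open>p \<in> {0..<b}\<^sup>m\<close> and a direction \<open>k < m\<close>, where \<open>m \<le> b\<close>, and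
  join \<open>(p, k)\<close> to \<open>(q, l)\<close> if \<open>k < l\<close> and \<open>q\<close> lies strictly above \<open>p\<close> on the line through \<open>p\<close> in
  direction \<open>k\<close>. This graph on \<open>m b\<^sup>m\<close> vertices is triangle-free. In an independent set, call a
  flag \<open>(p, k)\<close> top if \<open>k\<close> is the largest direction present at \<open>p\<close>; there are at most \<open>b\<^sup>m\<close> top flags,
  and each of the \<open>m b\<^sup>m\<^sup>-\<^sup>1 \<le> b\<^sup>m\<close> lines carries at most one flag that is not top. Hence independent sets
  have at most \<open>2 b\<^sup>m\<close> elements. Reading the coordinates of \<open>p\<close> as base-\<open>b\<close> digits, in both orders,
  turns lines into boxes in the plane, so the graph is semilinear of bounded complexity. Finally
  take \<open>m\<close> of order \<open>log n / log log n\<close> and \<open>b\<close> maximal with \<open>2 b\<^sup>m < n\<close>.\<close>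

section \<open>Base-\<open>b\<close> digits and blocks of leading digits\<close>

definition base_value :: "nat \<Rightarrow> nat \<Rightarrow> (nat \<Rightarrow> nat) \<Rightarrow> nat" where
  "base_value b m a = (\<Sum>i<m. a i * b ^ i)"

lemma base_value_0 [simp]: "base_value b 0 a = 0"
  by (simp add: base_value_def)

lemma base_value_Suc: "base_value b (Suc m) a = a 0 + b * base_value b m (\<lambda>i. a (Suc i))"
  by (simp add: base_value_def sum.lessThan_Suc_shift sum_distrib_left algebra_simps del: sum.lessThan_Suc)

lemma base_value_eq_iff:
  assumes "\<forall>i<m. a i < b" "\<forall>i<m. a' i < b"
  shows "base_value b m a = base_value b m a' \<longleftrightarrow> (\<forall>i<m. a i = a' i)"
  using assms
proof (induction m arbitrary: a a')
  case (Suc m)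
  have lt: "a 0 < b" "a' 0 < b" using Suc.prems by auto
  have "a 0 + b * u = a' 0 + b * v \<longleftrightarrow> a 0 = a' 0 \<and> u = v" for u v
  proof
    assume eq: "a 0 + b * u = a' 0 + b * v"
    then have "(a 0 + b * u) mod b = (a' 0 + b * v) mod b" by simp
    then have "a 0 = a' 0" using lt by simp
    then show "a 0 = a' 0 \<and> u = v" using eq lt by simp
  qed simp
  then show ?case
    using Suc.IH[of "\<lambda>i. a (Suc i)" "\<lambda>i. a' (Suc i)"] Suc.prems
    by (simp add: base_value_Suc All_less_Suc2)
qed simp

lemma base_value_div:
  assumes "\<forall>i<m. a i < b" "k \<le> m"
  shows "base_value b m a div b ^ k = base_value b (m - k) (\<lambda>i. a (i + k))"
  using assms
proof (induction k arbitrary: m a)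
  case (Suc k)
  then obtain m' where m: "m = Suc m'" by (cases m) auto
  have "a 0 < b" using Suc.prems m by auto
  then have "base_value b m a div b = base_value b m' (\<lambda>i. a (Suc i))"
    by (simp add: m base_value_Suc)
  then show ?case
    using Suc.IH[of m' "\<lambda>i. a (Suc i)"] Suc.prems
    by (simp add: m div_mult2_eq)
qed simp

text \<open>Dividing by \<open>b ^ k\<close> drops the \<open>k\<close> lowest digits, so agreement
  of all higher digits becomes equality of two quotients.\<close>

lemma base_value_div_eq_iff:
  assumes "\<forall>i<m. a i < b" "\<forall>i<m. a' i < b" "k \<le> m"
  shows "base_value b m a div b ^ k = base_value b m a' div b ^ k
    \<longleftrightarrow> (\<forall>i. k \<le> i \<and> i < m \<longrightarrow> a i = a' i)"
proof -
  have "(\<forall>i<m - k. a (i + k) = a' (i + k)) \<longleftrightarrow> (\<forall>i. k \<le> i \<and> i < m \<longrightarrow> a i = a' i)"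
    by (metis add.commute le_add2 le_add_diff_inverse less_diff_conv)
  then show ?thesis
    using assms base_value_eq_iff[of "m - k" "\<lambda>i. a (i + k)" b "\<lambda>i. a' (i + k)"]
    by (simp add: base_value_div)
qed

text \<open>Turns equality of quotients into two linear inequalities on \<open>q\<close> whose
  bounds depend on \<open>p\<close> alone, so that they can be stored as coordinates of the point
  that encodes \<open>p\<close>.\<close>

lemma div_eq_iff_box:
  fixes B p q :: nat
  assumes "B > 0"
  shows "q div B = p div B \<longleftrightarrow> B * (p div B) \<le> q \<and> q < B * (p div B) + B"
  using assms by (metis div_nat_eqI dividend_less_times_div times_div_less_eq_dividend mult_Suc_right add.commute)

section \<open>The flag graph: no triangles, small independent sets\<close>

definition flags :: "nat \<Rightarrow> nat \<Rightarrow> ((nat \<Rightarrow> nat) \<times> nat) set" where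
  "flags b m = ({..<m} \<rightarrow>\<^sub>E {..<b}) \<times> {..<m}"

definition below :: "(nat \<Rightarrow> nat) \<times> nat \<Rightarrow> (nat \<Rightarrow> nat) \<times> nat \<Rightarrow> bool" where
  "below u v \<longleftrightarrow> snd u < snd v \<and> (\<forall>i. i \<noteq> snd u \<longrightarrow> fst u i = fst v i)
     \<and> fst u (snd u) < fst v (snd u)"

lemma finite_flags [simp]: "finite (flags b m)"
  by (simp add: flags_def finite_PiE)

lemma card_flags: "card (flags b m) = m * b ^ m"
  by (simp add: flags_def card_cartesian_product card_funcsetE)

text \<open>In a triangle \<open>v\<close> and \<open>w\<close> would lie on one line in the direction of \<open>u\<close> and on another
  one in the direction of \<open>v\<close>.\<close>

lemma below_triangle_free: "\<not> (below u v \<and> below v w \<and> below u w)"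
proof
  assume *: "below u v \<and> below v w \<and> below u w"
  then have "snd v \<noteq> snd u" unfolding below_def by (metis less_irrefl)
  then have "fst v (snd v) = fst w (snd v)" using * unfolding below_def by metis
  then show False using * unfolding below_def by (metis less_irrefl)
qed

lemma card_indep_flags:
  assumes I: "I \<subseteq> flags b m" and ind: "\<And>u v. u \<in> I \<Longrightarrow> v \<in> I \<Longrightarrow> \<not> below u v"
    and "m \<le> b" "b > 0"
  shows "card I \<le> 2 * b ^ m"
proof -
  define T where "T = {u \<in> I. \<forall>l. (fst u, l) \<in> I \<longrightarrow> l \<le> snd u}"
  have finI: "finite I" using I finite_flags finite_subset by blast
  have finT: "finite T" using finI by (simp add: T_def)
  have "inj_on fst T"
    by (auto simp: inj_on_def T_def intro: le_antisym)
  moreover have "fst ` T \<subseteq> {..<m} \<rightarrow>\<^sub>E {..<b}"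
    using I unfolding T_def flags_def by fastforce
  ultimately have cardT: "card T \<le> b ^ m"
    using card_inj_on_le[of fst T "{..<m} \<rightarrow>\<^sub>E {..<b}"] by (simp add: finite_PiE card_funcsetE)
  \<comment> \<open>Each line carries at most one flag outside \<open>T\<close>, so sweeping such flags along
    their lines gives distinct flags.\<close>
  define h :: "((nat \<Rightarrow> nat) \<times> nat) \<times> nat \<Rightarrow> (nat \<Rightarrow> nat) \<times> nat"
    where "h = (\<lambda>((p, k), j). (p(k := j), k))"
  \<comment> \<open>Since \<open>(q, k)\<close> is not top, \<open>I\<close> contains some
    \<open>(q, l)\<close> with \<open>k < l\<close>, and \<open>(p, k)\<close> would be joined to
    it.\<close>
  have one: False
    if p: "(p, k) \<in> I - T" and q: "(q, k) \<in> I - T"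
      and line: "\<forall>i. i \<noteq> k \<longrightarrow> p i = q i" "p k < q k" for p q k
  proof -
    obtain l where "(q, l) \<in> I" "k < l" using q by (auto simp: T_def not_le)
    moreover have "below (p, k) (q, l)" using line \<open>k < l\<close> by (simp add: below_def)
    ultimately show False using ind p by blast
  qed
  have "inj_on h ((I - T) \<times> {..<b})"
  proof (rule inj_onI)
    fix s s' assume s: "s \<in> (I - T) \<times> {..<b}" "s' \<in> (I - T) \<times> {..<b}" and h: "h s = h s'"
    obtain p k j q k' j' where ss: "s = ((p, k), j)" "s' = ((q, k'), j')"
      by (metis prod.exhaust)
    have k: "k' = k" and eq: "p(k := j) = q(k := j')" using h by (auto simp: h_def ss)
    have p: "(p, k) \<in> I - T" and q: "(q, k) \<in> I - T" using s by (auto simp: ss k)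
    have line: "\<forall>i. i \<noteq> k \<longrightarrow> p i = q i" using eq by (metis fun_upd_other)
    moreover have "p k = q k"
      using one[OF p q] one[OF q p] line by (metis linorder_neqE_nat)
    ultimately have "p = q" by (metis ext)
    moreover have "j = j'" using eq by (metis fun_upd_same)
    ultimately show "s = s'" by (simp add: ss k)
  qed
  moreover have "h ` ((I - T) \<times> {..<b}) \<subseteq> flags b m"
    using I by (fastforce simp: h_def flags_def PiE_iff extensional_def split: if_splits)
  ultimately have "card ((I - T) \<times> {..<b}) \<le> card (flags b m)"
    using card_inj_on_le finite_flags by blast
  then have "card (I - T) * b \<le> m * b ^ m" by (simp add: card_flags card_cartesian_product)
  also have "\<dots> \<le> b * b ^ m" using \<open>m \<le> b\<close> by (rule mult_le_mono1)
  finally have "card (I - T) \<le> b ^ m" using \<open>b > 0\<close> by (simp add: mult.commute)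
  moreover have "card I = card T + card (I - T)"
    using finI by (subst card_Diff_subset) (auto simp: T_def card_mono intro: finT)
  ultimately show ?thesis using cardT by simp
qed

section \<open>Realising the flag graph by linear inequalities\<close>

text \<open>The coordinates are: the number \<open>x\<close> with the given digits, the number \<open>y\<close> with the digits
  reversed, the direction, and the endpoints of the half-open \<open>x\<close>- and \<open>y\<close>-intervals whose product
  box cuts out the line through the point in that direction: the \<open>x\<close>-interval fixes the digits
  above the direction, the \<open>y\<close>-interval those below it.\<close>

definition encode :: "nat \<Rightarrow> nat \<Rightarrow> (nat \<Rightarrow> nat) \<times> nat \<Rightarrow> nat \<Rightarrow> real" where
  "encode b m u i = (let x = base_value b m (fst u); y = base_value b m (\<lambda>j. fst u (m - 1 - j));
       B = b ^ Suc (snd u); C = b ^ (m - snd u) in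
     if i = 0 then real x else if i = 1 then real y else if i = 2 then real (snd u)
     else if i = 3 then real (B * (x div B)) else if i = 4 then real (B * (x div B) + B)
     else if i = 5 then real (C * (y div C)) else if i = 6 then real (C * (y div C) + C)
     else 0)"

definition box_below :: "(nat \<Rightarrow> real) \<Rightarrow> (nat \<Rightarrow> real) \<Rightarrow> bool" where
  "box_below u v \<longleftrightarrow> u 2 < v 2 \<and> u 0 < v 0 \<and> u 3 \<le> v 0 \<and> v 0 < u 4 \<and> u 5 \<le> v 1 \<and> v 1 < u 6"

text \<open>Each of the six inequalities compares a coordinate of one point with a coordinate of the
  other, hence is a sign condition on a linear function; the two orders of the points give 12
  functions.\<close>

lemma semilinear_box_below:
  assumes "finite V" "\<And>x. x \<in> V \<Longrightarrow> in_Rd 7 x"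
  shows "semilinear_graph 12 V (\<lambda>x y. box_below x y \<or> box_below y x)"
proof -
  define e :: "nat \<Rightarrow> nat \<Rightarrow> real" where "e = (\<lambda>i j. if j = i then 1 else 0)"
  define g :: "nat \<Rightarrow> nat \<Rightarrow> linfun" where "g = (\<lambda>i j. (e i, \<lambda>l. - e j l, 0))"
  define g' :: "nat \<Rightarrow> nat \<Rightarrow> linfun" where "g' = (\<lambda>i j. (\<lambda>l. - e j l, e i, 0))"
  define fs where "fs = [g 2 2, g 0 0, g 3 0, g' 0 4, g 5 1, g' 1 6,
    g' 2 2, g' 0 0, g' 3 0, g 0 4, g' 5 1, g 1 6]"
  \<comment> \<open>\<open>D r\<close> reads six consecutive entries from position \<open>r\<close>:
    the first component for a strict inequality, the second for a weak one.\<close>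
  define D :: "nat \<Rightarrow> (bool \<times> bool \<times> bool) list \<Rightarrow> bool" where
    "D = (\<lambda>r s. fst (s ! r) \<and> fst (s ! (r + 1)) \<and> fst (snd (s ! (r + 2))) \<and> fst (s ! (r + 3))
       \<and> fst (snd (s ! (r + 4))) \<and> fst (s ! (r + 5)))"
  have e: "(\<Sum>l<7. e i l * x l) = x i" if "i < 7" for i and x :: "nat \<Rightarrow> real"
    using that by (simp add: e_def if_distrib[of "\<lambda>c. c * _"] cong: if_cong)
  have g: "eval_lin 7 (g i j) x y = x i - y j" "eval_lin 7 (g' i j) x y = y i - x j"
    if "i < 7" "j < 7" for i j x y
    using that by (simp_all add: eval_lin_def g_def g'_def e sum_negf)
  have D: "D 0 (sign_pattern 7 fs x y) \<longleftrightarrow> box_below x y"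
    "D 6 (sign_pattern 7 fs x y) \<longleftrightarrow> box_below y x" for x y
    by (simp_all add: D_def sign_pattern_def fs_def g box_below_def)
  show ?thesis
    unfolding semilinear_graph_def
    using assms
    by (intro conjI exI[of _ 7] exI[of _ fs] exI[of _ "\<lambda>s. D 0 s \<or> D 6 s"])
       (auto simp: D, simp add: fs_def)
qed

lemma in_Rd_encode: "in_Rd 7 (encode b m u)"
  by (simp add: in_Rd_def encode_def Let_def)

lemma inj_on_encode: "inj_on (encode b m) (flags b m)"
proof (rule inj_onI)
  fix u v assume uv: "u \<in> flags b m" "v \<in> flags b m" and eq: "encode b m u = encode b m v"
  have "encode b m u 0 = encode b m v 0" "encode b m u 2 = encode b m v 2" using eq by auto
  then have "base_value b m (fst u) = base_value b m (fst v)" and s: "snd u = snd v"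
    by (simp_all add: encode_def Let_def)
  moreover have mem: "fst u \<in> {..<m} \<rightarrow>\<^sub>E {..<b}" "fst v \<in> {..<m} \<rightarrow>\<^sub>E {..<b}"
    using uv unfolding flags_def mem_Times_iff by blast+
  ultimately have "\<forall>i<m. fst u i = fst v i"
    using base_value_eq_iff[of m "fst u" b "fst v"] by (simp add: PiE_iff)
  then have "fst u = fst v" using mem by (intro PiE_ext) auto
  then show "u = v" using s by (simp add: prod_eq_iff)
qed

text \<open>The two intervals of the box force agreement in all digits except digit
  \<open>k\<close>. Along such a line the order of the \<open>x\<close>-values is the order of the
  digits at \<open>k\<close>.\<close>

lemma box_below_encode_iff:
  assumes uv: "u \<in> flags b m" "v \<in> flags b m"
  shows "box_below (encode b m u) (encode b m v) \<longleftrightarrow> below u v"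
proof -
  obtain p k q l where u: "u = (p, k)" and v: "v = (q, l)" by fastforce
  \<comment> \<open>Both points take the value \<open>undefined\<close> at indices from
    \<open>m\<close> on, so \<open>below\<close> may quantify over all indices.\<close>
  have p: "\<forall>i<m. p i < b" and q: "\<forall>i<m. q i < b" and k: "k < m"
    and outside: "\<forall>i\<ge>m. q i = p i"
    using uv by (auto simp: u v flags_def PiE_iff extensional_def)
  have b: "b > 0" using p k by (metis not_less_zero neq0_conv)
  let ?x = "base_value b m" and ?y = "\<lambda>a. base_value b m (\<lambda>j. a (m - 1 - j))"
  have x: "?x q div b ^ Suc k = ?x p div b ^ Suc k \<longleftrightarrow> (\<forall>i. k < i \<and> i < m \<longrightarrow> q i = p i)"
    using base_value_div_eq_iff[OF q p, of "Suc k"] k by (simp add: Suc_le_eq)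
  \<comment> \<open>In the reversed number, positions from \<open>m - k\<close> on hold exactly the
    original digits below \<open>k\<close>.\<close>
  have "?y q div b ^ (m - k) = ?y p div b ^ (m - k)
      \<longleftrightarrow> (\<forall>i. m - k \<le> i \<and> i < m \<longrightarrow> q (m - 1 - i) = p (m - 1 - i))"
    by (rule base_value_div_eq_iff) (use p q in auto)
  also have "\<dots> \<longleftrightarrow> (\<forall>i<k. q i = p i)"
  proof (intro iffI allI impI)
    fix i assume *: "\<forall>i. m - k \<le> i \<and> i < m \<longrightarrow> q (m - 1 - i) = p (m - 1 - i)" and "i < k"
    then show "q i = p i" using k *[rule_format, of "m - 1 - i"] by auto
  next
    fix i assume *: "\<forall>i<k. q i = p i" and "m - k \<le> i \<and> i < m"
    then show "q (m - 1 - i) = p (m - 1 - i)" using k by auto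
  qed
  finally have y: "?y q div b ^ (m - k) = ?y p div b ^ (m - k) \<longleftrightarrow> (\<forall>i<k. q i = p i)" .
  have less: "?x p < ?x q \<longleftrightarrow> p k < q k" if "\<forall>i. i \<noteq> k \<longrightarrow> p i = q i"
  proof -
    have "?x a = a k * b ^ k + (\<Sum>i\<in>{..<m} - {k}. a i * b ^ i)" for a
      unfolding base_value_def using k by (simp add: sum.remove)
    moreover have "(\<Sum>i\<in>{..<m} - {k}. p i * b ^ i) = (\<Sum>i\<in>{..<m} - {k}. q i * b ^ i)"
      using that by (intro sum.cong) auto
    ultimately show ?thesis using b by simp
  qed
  have line: "(\<forall>i. i \<noteq> k \<longrightarrow> p i = q i)
      \<longleftrightarrow> (\<forall>i. k < i \<and> i < m \<longrightarrow> q i = p i) \<and> (\<forall>i<k. q i = p i)"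
  proof (intro iffI allI impI)
    fix i assume "(\<forall>i. k < i \<and> i < m \<longrightarrow> q i = p i) \<and> (\<forall>i<k. q i = p i)" "i \<noteq> k"
    then show "p i = q i"
      using outside by (cases i k rule: linorder_cases; cases "i < m") auto
  qed auto
  have "box_below (encode b m u) (encode b m v) \<longleftrightarrow>
      k < l \<and> ?x p < ?x q \<and> ?x q div b ^ Suc k = ?x p div b ^ Suc k
        \<and> ?y q div b ^ (m - k) = ?y p div b ^ (m - k)"
    using div_eq_iff_box[of "b ^ Suc k" "?x q" "?x p"] div_eq_iff_box[of "b ^ (m - k)" "?y q" "?y p"] b
    unfolding box_below_def
    by (simp add: encode_def Let_def u v del: of_nat_mult of_nat_add power_Suc)
  also have "\<dots> \<longleftrightarrow> k < l \<and> (\<forall>i. i \<noteq> k \<longrightarrow> p i = q i) \<and> p k < q k"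
    using x y line less by blast
  finally show ?thesis by (simp add: below_def u v)
qed

section \<open>Semilinear Ramsey numbers and the bound from the flag graph\<close>

lemma semilinear_graph_subset:
  assumes "semilinear_graph t V E" "W \<subseteq> V"
  shows "semilinear_graph t W E"
proof -
  obtain d fs \<phi> where *: "finite V" "d > 0" "length fs = t" "\<forall>x\<in>V. in_Rd d x"
    "\<forall>x\<in>V. \<forall>y\<in>V. x \<noteq> y \<longrightarrow> (\<phi> (sign_pattern d fs x y) \<longleftrightarrow> \<phi> (sign_pattern d fs y x))"
    "\<forall>x\<in>V. \<forall>y\<in>V. x \<noteq> y \<longrightarrow> (E x y \<longleftrightarrow> \<phi> (sign_pattern d fs x y))"
    using assms(1) unfolding semilinear_graph_def by (elim conjE exE) iprover
  show ?thesis
    unfolding semilinear_graph_def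
  proof (intro conjI exI[of _ d] exI[of _ fs] exI[of _ \<phi>])
    show "finite W" using *(1) assms(2) by (rule rev_finite_subset)
  qed (use * assms(2) in \<open>simp_all add: subset_iff\<close>)
qed

lemma semilinear_graph_sym:
  assumes "semilinear_graph t V E" "x \<in> V" "y \<in> V" "E x y"
  shows "E y x"
proof (cases "x = y")
  case False
  then show ?thesis
    using assms unfolding semilinear_graph_def by (elim conjE exE) metis
qed (use assms in simp)

text \<open>\<open>LEAST\<close> has the defining property only if some number has it; the classical
  Ramsey theorem provides one.\<close>

lemma semilinear_ramsey_works:
  assumes "semilinear_graph t V E" "card V = semilinear_ramsey t s n"
  shows "has_clique V E s \<or> has_indep V E n"
proof -
  let ?P = "\<lambda>N. \<forall>V E. semilinear_graph t V E \<and> card V = N \<longrightarrow> has_clique V E s \<or> has_indep V E n"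
  obtain r where r: "\<And>(V :: (nat \<Rightarrow> real) set) F. finite V \<Longrightarrow> r \<le> card V \<Longrightarrow>
      \<exists>R\<subseteq>V. card R = s \<and> clique R F \<or> card R = n \<and> indep R F"
    using ramsey2[of s n] by blast
  have "?P r"
  proof (intro allI impI)
    fix V E assume *: "semilinear_graph t V E \<and> card V = r"
    then have fin: "finite V" by (simp add: semilinear_graph_def)
    have sym: "\<And>x y. x \<in> V \<Longrightarrow> y \<in> V \<Longrightarrow> E x y \<Longrightarrow> E y x"
      using * semilinear_graph_sym by blast
    \<comment> \<open>The library's \<open>clique\<close> and \<open>indep\<close> take edges as
      two-element sets.\<close>
    define F where "F = {{x, y} | x y. x \<in> V \<and> y \<in> V \<and> x \<noteq> y \<and> E x y}"
    have F: "{x, y} \<in> F \<longleftrightarrow> E x y" if "x \<in> V" "y \<in> V" "x \<noteq> y" for x y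
      using that sym by (auto simp: F_def doubleton_eq_iff)
    obtain R where "R \<subseteq> V" and R: "card R = s \<and> clique R F \<or> card R = n \<and> indep R F"
      using r[OF fin] * by blast
    have "(clique R F \<longrightarrow> (\<forall>x\<in>R. \<forall>y\<in>R. x \<noteq> y \<longrightarrow> E x y))
        \<and> (indep R F \<longrightarrow> (\<forall>x\<in>R. \<forall>y\<in>R. x \<noteq> y \<longrightarrow> \<not> E x y))"
      using F \<open>R \<subseteq> V\<close> unfolding clique_def indep_def by (meson subsetD)
    then show "has_clique V E s \<or> has_indep V E n"
      using R \<open>R \<subseteq> V\<close> unfolding has_clique_def has_indep_def by blast
  qed
  then have "?P (semilinear_ramsey t s n)"
    unfolding semilinear_ramsey_def by (rule LeastI)
  then show ?thesis using assms by blast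
qed

text \<open>The definition speaks of graphs with exactly \<open>N\<close> vertices. A larger graph
  is handled by passing to an induced subgraph of that size, which is again semilinear.\<close>

lemma card_less_semilinear_ramsey:
  assumes "semilinear_graph t V E" "\<not> has_clique V E s" "\<not> has_indep V E n"
  shows "card V < semilinear_ramsey t s n"
proof (rule ccontr)
  assume "\<not> ?thesis"
  then obtain W where W: "W \<subseteq> V" "card W = semilinear_ramsey t s n"
    by (metis not_less obtain_subset_with_card_n)
  then have "has_clique W E s \<or> has_indep W E n"
    using semilinear_ramsey_works semilinear_graph_subset assms(1) by blast
  then show False
    using assms(2,3) W(1) unfolding has_clique_def has_indep_def by (metis subset_trans)
qed

lemma semilinear_ramsey_12_3_gt:
  assumes "m \<le> b" "b > 0" "2 * b ^ m < n"
  shows "m * b ^ m < semilinear_ramsey 12 3 n"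
proof -
  define V where "V = encode b m ` flags b m"
  define E where "E = (\<lambda>x y. box_below x y \<or> box_below y x)"
  have sem: "semilinear_graph 12 V E"
    unfolding E_def by (rule semilinear_box_below) (auto simp: V_def in_Rd_encode)
  have E: "E (encode b m u) (encode b m v) \<longleftrightarrow> below u v \<or> below v u"
    if "u \<in> flags b m" "v \<in> flags b m" for u v
    using that by (simp add: E_def box_below_encode_iff)
  have "\<not> has_clique V E 3"
  proof
    assume "has_clique V E 3"
    then obtain K where K: "K \<subseteq> V" "card K = 3" "\<forall>x\<in>K. \<forall>y\<in>K. x \<noteq> y \<longrightarrow> E x y"
      unfolding has_clique_def by blast
    then obtain x y z where xyz: "K = {x, y, z}" "x \<noteq> y" "y \<noteq> z" "x \<noteq> z"
      by (auto simp: card_3_iff)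
    then obtain u v w where "x = encode b m u" "y = encode b m v" "z = encode b m w"
      "u \<in> flags b m" "v \<in> flags b m" "w \<in> flags b m"
      using K(1) by (auto simp: V_def)
    then have adj: "below u v \<or> below v u" "below v w \<or> below w v" "below u w \<or> below w u"
      using K(3) xyz E by auto
    \<comment> \<open>Directions increase along \<open>below\<close>, which excludes cyclic
      orientations. The remaining ones are the six linear orders of \<open>u\<close>,
      \<open>v\<close>, \<open>w\<close>, one for each instance of
      \<open>below_triangle_free\<close>.\<close>
    have snd: "below a c \<Longrightarrow> snd a < snd c" for a c by (simp add: below_def)
    show False
      using adj below_triangle_free[of u v w] below_triangle_free[of u w v] below_triangle_free[of v u w]
        below_triangle_free[of v w u] below_triangle_free[of w u v] below_triangle_free[of w v u]
        snd[of u v] snd[of v u] snd[of v w] snd[of w v] snd[of u w] snd[of w u]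
      by linarith
  qed
  moreover have "\<not> has_indep V E n"
  proof
    assume "has_indep V E n"
    then obtain J where J: "J \<subseteq> V" "card J = n" "\<forall>x\<in>J. \<forall>y\<in>J. x \<noteq> y \<longrightarrow> \<not> E x y"
      unfolding has_indep_def by blast
    define I where "I = {u \<in> flags b m. encode b m u \<in> J}"
    have "J = encode b m ` I" using J(1) by (auto simp: V_def I_def)
    moreover have inj: "inj_on (encode b m) I"
      using inj_on_encode by (rule inj_on_subset) (auto simp: I_def)
    ultimately have "card I = n" using J(2) by (simp add: card_image)
    moreover have "\<not> below u v" if "u \<in> I" "v \<in> I" for u v
    proof
      assume uv: "below u v"
      then have "u \<noteq> v" by (auto simp: below_def)
      then have "encode b m u \<noteq> encode b m v" using inj that by (auto simp: inj_on_def)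
      then show False using J(3) that E[of u v] uv by (auto simp: I_def)
    qed
    then have "card I \<le> 2 * b ^ m"
      using assms by (intro card_indep_flags) (auto simp: I_def)
    ultimately show False using assms(3) by simp
  qed
  moreover have "card V = m * b ^ m"
    by (simp add: V_def card_image inj_on_encode card_flags)
  ultimately show ?thesis using card_less_semilinear_ramsey[OF sem] by metis
qed

section \<open>Choice of the parameters\<close>

text \<open>Take \<open>b\<close> maximal with \<open>2 * b ^ m < n\<close>. The hypothesis gives
  \<open>m \<le> b\<close>, and maximality gives \<open>n \<le> 2 * (b + 1) ^ m\<close>, where
  \<open>(1 + 1 / b) ^ m \<le> exp (m / b) \<le> exp 1\<close>.\<close>

lemma semilinear_ramsey_12_3_ge:
  fixes n m :: nat
  assumes "2 * m ^ m < n" "m > 0"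
  shows "real (semilinear_ramsey 12 3 n) \<ge> real m * real n / (2 * exp 1)"
proof -
  define S where "S = {b. 2 * b ^ m < n}"
  have "b \<le> n" if "b \<in> S" for b
  proof -
    have "b \<le> b ^ m" using assms(2) by (cases "b = 0") (auto intro: self_le_power)
    then show ?thesis using that by (simp add: S_def)
  qed
  then have fin: "finite S" by (meson finite_nat_set_iff_bounded_le)
  define b where "b = Max S"
  have mS: "m \<in> S" using assms by (simp add: S_def)
  have bS: "b \<in> S" using Max_in[OF fin] mS b_def by auto
  have mb: "m \<le> b" using Max_ge[OF fin mS] b_def by simp
  have "Suc b \<notin> S" using Max_ge[OF fin, of "Suc b"] b_def by auto
  then have "n \<le> 2 * Suc b ^ m" by (simp add: S_def)
  then have "real n \<le> real (2 * Suc b ^ m)" by (simp only: of_nat_le_iff)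
  also have "\<dots> = 2 * real b ^ m * (1 + 1 / real b) ^ m"
    using mb assms(2) by (simp add: power_mult_distrib[symmetric] field_simps)
  also have "(1 + 1 / real b) ^ m \<le> exp (1 / real b) ^ m"
    by (intro power_mono exp_ge_add_one_self) auto
  also have "exp (1 / real b) ^ m = exp (real m / real b)"
    by (simp add: exp_of_nat_mult[symmetric])
  also have "\<dots> \<le> exp 1" using mb assms(2) by simp
  finally have n: "real n \<le> 2 * real b ^ m * exp 1" by (simp add: mult_left_mono)
  have "real m * real n / (2 * exp 1) \<le> real m * real b ^ m"
    using mult_left_mono[OF n, of "real m"] by (simp add: field_simps)
  also have "\<dots> \<le> real (semilinear_ramsey 12 3 n)"
    using semilinear_ramsey_12_3_gt[OF mb, of n] bS mb assms(2)
    by (simp add: S_def flip: of_nat_mult of_nat_power)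
  finally show ?thesis .
qed

text \<open>With \<open>L = ln n\<close> and \<open>m\<close> the floor of
  \<open>z = L / (2 * ln L)\<close>, \<open>m * ln m \<le> z * ln L = L / 2\<close>, so
  \<open>m ^ m\<close> is at most the square root of \<open>n\<close>, which exceeds 2. Rounding
  down costs at most a factor 2 because \<open>z \<ge> 1\<close>.\<close>

lemma exists_self_power_less:
  fixes n :: nat
  assumes "ln (ln (real n)) \<ge> 1" "n \<ge> 3"
  shows "\<exists>m>0. 2 * m ^ m < n \<and> real m \<ge> ln (real n) / (4 * ln (ln (real n)))"
proof -
  define L where "L = ln (real n)"
  have L: "L > 0" "ln L \<ge> 1" "ln L \<noteq> 0" using assms by (auto simp: L_def)
  define z where "z = L / (2 * ln L)"
  \<comment> \<open>With \<open>w = ln L\<close>, \<open>1 + w + w^2 / 2 \<ge> 2 * w\<close> follows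
    from \<open>(w - 1)^2 \<ge> 0\<close>.\<close>
  have "exp (ln L) \<ge> 1 + ln L + (ln L)\<^sup>2 / 2"
    using exp_lower_Taylor_quadratic[of "ln L"] L by linarith
  then have "L \<ge> 2 * ln L" using L sum_squares_ge_zero[of "ln L - 1" 0]
    by (simp add: power2_eq_square algebra_simps)
  then have z: "z \<ge> 1" using L by (simp add: z_def)
  have zL: "z \<le> L" using L frac_le[of L L 1 "2 * ln L"] by (simp add: z_def)
  define m where "m = nat \<lfloor>z\<rfloor>"
  have m: "real m \<le> z" "real m > z - 1" "m \<ge> 1"
    using z by (auto simp: m_def le_nat_floor)
  have "ln (real m) \<le> ln L" using m zL L by (intro ln_mono) auto
  then have "real m * ln (real m) \<le> z * ln L" using m L by (intro mult_mono) auto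
  also have "\<dots> = L / 2" using L(3) by (simp add: z_def del: ln_eq_zero_iff)
  finally have "ln (real m ^ m) \<le> L / 2" using m by (simp add: ln_realpow)
  moreover have "ln 2 < L / 2"
  proof -
    have "exp 1 \<le> L" using L by (metis exp_le_cancel_iff exp_ln)
    moreover have "exp (1::real) \<ge> 2" using exp_ge_add_one_self[of "1::real"] by simp
    moreover have "ln (2::real) < 1" using ln_less_self[of 2] ln_2_less_1 by simp
    ultimately show ?thesis by linarith
  qed
  ultimately have "ln (2 * real m ^ m) < ln (real n)" using m by (simp add: ln_mult L_def)
  then have "2 * real m ^ m < real n" using m assms(2) by (subst (asm) ln_less_cancel_iff) auto
  then have "2 * m ^ m < n" by (simp flip: of_nat_less_iff[where 'a = real])
  moreover have "z / 2 \<le> real m" using m z by linarith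
  ultimately show ?thesis using m by (intro exI[of _ m]) (auto simp: z_def L_def)
qed

theorem theorem1p2:
  shows "\<exists>(t::nat)>0. \<exists>c::real>0. \<forall>n::nat\<ge>3.
    real (semilinear_ramsey t 3 n) \<ge> c * real n * (ln (real n) / ln (ln (real n)))"
proof -
  \<comment> \<open>This yields \<open>exp 1 \<le> (6 / 5) ^ 6 < 3\<close>, so that
    \<open>ln (ln n)\<close> is positive already at \<open>n = 3\<close>.\<close>
  have "1 - 1 / 6 \<le> exp (- 1 / 6 :: real)"
    using exp_ge_add_one_self[of "- 1 / 6 :: real"] by simp
  then have "(5 / 6) ^ 6 \<le> exp (- 1 / 6 :: real) ^ 6" by (intro power_mono) auto
  also have "\<dots> = exp (- 1)" by (simp flip: exp_of_nat_mult)
  finally have "exp 1 * (5 / 6) ^ 6 \<le> (1::real)" by (simp add: exp_minus field_simps)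
  then have "exp 1 < (3::real)" by (simp add: power_divide)
  then have "1 < ln (3::real)"
    by (metis exp_less_cancel_iff exp_ln zero_less_numeral)
  then have A: "ln (ln (3::real)) > 0" by simp
  \<comment> \<open>The first term combines the factor \<open>1 / 4\<close> in the choice of
    \<open>m\<close> with \<open>1 / (2 * exp 1)\<close>. The second serves small \<open>n\<close>,
    where \<open>m = 1\<close> gives \<open>n / (2 * exp 1)\<close> and the quotient of logarithms
    is at most \<open>exp 1 / ln (ln 3)\<close>.\<close>
  define c :: real where "c = min (1 / (8 * exp 1)) (ln (ln 3) / (2 * exp 1 * exp 1))"
  have c: "c > 0" using A by (simp add: c_def)
  have "real (semilinear_ramsey 12 3 n) \<ge> c * real n * (ln (real n) / ln (ln (real n)))"
    if n: "n \<ge> 3" for n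
  proof -
    let ?L = "ln (real n)"
    have LL: "ln ?L \<ge> ln (ln 3)" and L: "?L > 1"
      using n \<open>1 < ln 3\<close> by (auto intro!: ln_mono order.strict_trans2[OF \<open>1 < ln 3\<close>])
    show ?thesis
    proof (cases "ln ?L \<ge> 1")
      case True
      then obtain m where m: "m > 0" "2 * m ^ m < n" "real m \<ge> ?L / (4 * ln ?L)"
        using exists_self_power_less n by blast
      have "c * real n * (?L / ln ?L) \<le> 1 / (8 * exp 1) * real n * (?L / ln ?L)"
        using L True by (intro mult_right_mono) (auto simp: c_def)
      also have "\<dots> = ?L / (4 * ln ?L) * real n / (2 * exp 1)" by (simp add: mult_ac)
      also have "\<dots> \<le> real m * real n / (2 * exp 1)"
        using m(3) by (intro divide_right_mono mult_right_mono) auto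
      also have "\<dots> \<le> real (semilinear_ramsey 12 3 n)"
        using semilinear_ramsey_12_3_ge m by blast
      finally show ?thesis .
    next
      case False
      then have "?L \<le> exp 1" using L by (metis exp_le_cancel_iff exp_ln le_less_linear less_imp_le order.strict_trans zero_less_one)
      then have "?L / ln ?L \<le> exp 1 / ln (ln 3)"
        using LL A L by (intro frac_le) auto
      then have "c * real n * (?L / ln ?L) \<le> ln (ln 3) / (2 * exp 1 * exp 1) * real n * (exp 1 / ln (ln 3))"
        using L LL A by (intro mult_mono) (auto simp: c_def)
      also have "\<dots> = real 1 * real n / (2 * exp 1)" using A by simp
      also have "\<dots> \<le> real (semilinear_ramsey 12 3 n)"
        using semilinear_ramsey_12_3_ge[of 1 n] n by simp
      finally show ?thesis .
    qed
  qed
  then show ?thesis using c by (intro exI[of _ 12] exI[of _ c]) auto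
qed

end
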